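(* Let $m,n\geq1$ be integers and let $\mathcal{S}=\{f_1,\dots,f_N\}$ be a multiplicative system with $f_i:I_i\to\mathbb{R}$, $f_i(x)=q_ix$, where $q_i\in\mathbb{Q}\setminus\{0\}$ and $I_i$ is a closed interval with rational bounds included in $[a_i,a_i+1]$ for some $a_i\in\mathbb{Z}$. Let $Y_{\mathcal{S}}$ be the associated SFT on $BS(m,n)$. If $\mathcal{S}$ has no periodic point, then $Y_{\mathcal{S}}$ is a weakly aperiodic SFT.
   Context: $BS(m,n)=\langle a,b \mid b a^{m} b^{-1} = a^n\rangle$. It acts on configurations $x\in\mathcal{A}^{BS(m,n)}$ ($\mathcal{A}$ finite) by $(g\cdot x)_h=x_{g^{-1}h}$; $x$ is strongly periodic if its orbit is finite. A subshift of finite type (SFT) is the set of all configurations avoiding a finite set of finite patterns (up to translation). A subshift is weakly aperiodic if it is non-empty and contains no strongly periodic configuration. Multiplicative systems and periodic points. A multiplicative system is a finite set of non-zero linear maps between closed intervals of $\mathbb{R}$ (the domains may overlap). For $k>0$, $\mathcal{S}^k(x)$ is the set of $y\in\mathbb{R}$ for which there are $i_1,\dots,i_k$ such that $f_{i_k}\circ\cdots\circ f_{i_1}(x)$ is defined and equals $y$. A periodic point of $\mathcal{S}$ is $x\in\mathbb{R}$ such that $x\in\mathcal{S}^k(x)$ for some integer $k\geq1$. Wang tiles. A Wang tile of $BS(m,n)$ is a tuple $s=(t_1,\dots,t_m,l,r,b_1,\dots,b_n)$ of colors, with $s(\text{top}_k)=t_k$, $s(\text{left})=l$, $s(\text{right})=r$,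 $s(\text{bottom}_j)=b_j$. For a finite tileset $\tau$, $X^\tau$ is the set of $T\in\tau^{BS(m,n)}$ such that for all $g$, all $1\le k\le m$ and $1\le j\le n$: $T_g(\text{right})=T_{ga^m}(\text{left})$ and $T_g(\text{top}_k)=T_{ga^{k-j}b}(\text{bottom}_j)$. The tilesets $\tau_{q,I}$. The height $\|g\|_b$ of $g$ is the number of $b$'s minus the number of $b^{-1}$'s in any word representing $g$. Define $\alpha$ on words over $\{a,b,a^{-1},b^{-1}\}$ by $\alpha(\epsilon)=0$ for the empty word, $\alpha(wb)=\alpha(wb^{-1})=\alpha(w)$, $\alpha(wa)=\alpha(w)+(n/m)^{\|w\|_b}$, $\alpha(wa^{-1})=\alpha(w)-(n/m)^{\|w\|_b}$; this induces a well-defined map $\alpha:BS(m,n)\to\mathbb{R}$. Let $\lambda(g)=\frac1m\left(\frac mn\right)^{\|g\|_b}\alpha(g)$. For $q\in\mathbb{Q}$, $g\in BS(m,n)$, $x\in\mathbb{R}$ put $t_j(g,x)=\lfloor(m\lambda(g)+j)x\rfloor-\lfloor(m\lambda(g)+j-1)x\rfloor$ for $1\le j\le m$, $b_j(g,x)=\lfloor(n\lambda(g)+j)qx\rfloor-\lfloor(n\lambda(g)+j-1)qx\rfloor$ for $1\le j\le n$, $l(g,x)=\frac qm\lfloor m\lambda(g)x\rfloor-\frac1n\lfloor n\lambda(g)qx\rfloor$, $r(g,x)=\frac qm\lfloor(m\lambda(g)+m)x\rfloor-\frac1n\lfloor(n\lambda(g)+n)qx\rfloor$, and let $\tau_{q,I}$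 be the set of all tiles $(t_1(g,x),\dots,t_m(g,x),l(g,x),r(g,x),b_1(g,x),\dots,b_n(g,x))$ with $g\in BS(m,n)$, $x\in I$. The SFT $Y_{\mathcal{S}}$. Write $I_i=[a_i+\frac{d_1^i}{e_1^i},\,a_i+1-\frac{d_2^i}{e_2^i}]$ with integers $d_1^i,d_2^i\ge0$, $e_1^i,e_2^i\ge1$ (fixed once and for all). Let $\tau$ be the (finite) set of tiles $(t_1,\dots,t_m,(l,i),(r,i),b_1,\dots,b_n)$ with $i\in\{1,\dots,N\}$ and $(t_1,\dots,t_m,l,r,b_1,\dots,b_n)\in\tau_{q_i,[a_i,a_i+1]}$; such a tile has color $i$. $Y_{\mathcal{S}}$ is the set of $T\in X^\tau$ such that, whenever $T_g$ has color $i$, in the sequence $(T_{ga^{j}}(\text{top}_1))_{j\in\mathbb{Z}}$ of labels on the upper side of the line of $g$, every $e_1^i$ consecutive labels contain at least $d_1^i$ labels $a_i+1$, and every $e_2^i$ consecutive labels contain at least $d_2^i$ labels $a_i$.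
   Formalization: Non-emptiness of Y_S is claimed only if S has an immortal point (some x with S^k(x) non-empty for all k ≥ 1): for f(x)=3x on [1,2] there is no periodic point, yet Y_S is empty. That Y_S is an SFT without strongly periodic configurations is proved as stated. *)

theory Defs
  imports Complex_Main "HOL-Library.FuncSet" "HOL-Algebra.Group"
begin

section \<open>Subshifts on a group\<close>

text \<open>Configurations over an alphabet \<open>A\<close> are the extensional functions
  \<open>carrier G \<rightarrow>\<^sub>E A\<close>.\<close>

definition shift_action :: "('g, 'z) monoid_scheme \<Rightarrow> 'g \<Rightarrow> ('g \<Rightarrow> 'c) \<Rightarrow> ('g \<Rightarrow> 'c)" where
  "shift_action G g x = (\<lambda>h\<in>carrier G. x (inv\<^bsub>G\<^esub> g \<otimes>\<^bsub>G\<^esub> h))"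

definition strongly_periodic :: "('g, 'z) monoid_scheme \<Rightarrow> ('g \<Rightarrow> 'c) \<Rightarrow> bool" where
  "strongly_periodic G x \<longleftrightarrow> finite ((\<lambda>g. shift_action G g x) ` carrier G)"

text \<open>A finite pattern is a map with finite domain (its support).\<close>

definition appears_in :: "('g, 'z) monoid_scheme \<Rightarrow> ('g \<rightharpoonup> 'c) \<Rightarrow> ('g \<Rightarrow> 'c) \<Rightarrow> bool" where
  "appears_in G p x \<longleftrightarrow> (\<exists>g\<in>carrier G. \<forall>h\<in>dom p. p h = Some (x (g \<otimes>\<^bsub>G\<^esub> h)))"

definition is_SFT :: "('g, 'z) monoid_scheme \<Rightarrow> 'c set \<Rightarrow> ('g \<Rightarrow> 'c) set \<Rightarrow> bool" where
  "is_SFT G A X \<longleftrightarrow> finite A \<and>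
     (\<exists>F :: ('g \<rightharpoonup> 'c) set. finite F \<and>
        (\<forall>p\<in>F. finite (dom p) \<and> dom p \<subseteq> carrier G \<and> ran p \<subseteq> A) \<and>
        X = {x \<in> carrier G \<rightarrow>\<^sub>E A. \<forall>p\<in>F. \<not> appears_in G p x})"

definition weakly_aperiodic :: "('g, 'z) monoid_scheme \<Rightarrow> ('g \<Rightarrow> 'c) set \<Rightarrow> bool" where
  "weakly_aperiodic G X \<longleftrightarrow> X \<noteq> {} \<and> (\<forall>x\<in>X. \<not> strongly_periodic G x)"


section \<open>Baumslag--Solitar groups\<close>

datatype letter = La | La_inv | Lb | Lb_inv

primrec letter_inv :: "letter \<Rightarrow> letter" where
  "letter_inv La = La_inv"
| "letter_inv La_inv = La"
| "letter_inv Lb = Lb_inv"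
| "letter_inv Lb_inv = Lb"

text \<open>The least congruence on words containing the defining relation and the free cancellations.\<close>

inductive bs_eq :: "nat \<Rightarrow> nat \<Rightarrow> letter list \<Rightarrow> letter list \<Rightarrow> bool" for m n where
  refl: "bs_eq m n u u"
| sym: "bs_eq m n u v \<Longrightarrow> bs_eq m n v u"
| trans: "bs_eq m n u v \<Longrightarrow> bs_eq m n v w \<Longrightarrow> bs_eq m n u w"
| cong: "bs_eq m n u u' \<Longrightarrow> bs_eq m n v v' \<Longrightarrow> bs_eq m n (u @ v) (u' @ v')"
| cancel: "bs_eq m n [x, letter_inv x] []"
| relator: "bs_eq m n ([Lb] @ replicate m La @ [Lb_inv]) (replicate n La)"

definition bs_class :: "nat \<Rightarrow> nat \<Rightarrow> letter list \<Rightarrow> letter list set" where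
  "bs_class m n w = {v. bs_eq m n w v}"

definition BS :: "nat \<Rightarrow> nat \<Rightarrow> letter list set monoid" where
  "BS m n = \<lparr>carrier = range (bs_class m n),
             mult = (\<lambda>X Y. \<Union>u\<in>X. \<Union>v\<in>Y. bs_class m n (u @ v)),
             one = bs_class m n []\<rparr>"

abbreviation gen_a :: "nat \<Rightarrow> nat \<Rightarrow> letter list set" where
  "gen_a m n \<equiv> bs_class m n [La]"

abbreviation gen_b :: "nat \<Rightarrow> nat \<Rightarrow> letter list set" where
  "gen_b m n \<equiv> bs_class m n [Lb]"

lemma bs_class_eq_iff: "bs_class m n u = bs_class m n v \<longleftrightarrow> bs_eq m n u v"
proof
  assume "bs_class m n u = bs_class m n v"
  then show "bs_eq m n u v"
    using bs_eq.refl[of m n v] by (auto simp: bs_class_def)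
next
  assume uv: "bs_eq m n u v"
  show "bs_class m n u = bs_class m n v"
    unfolding bs_class_def using bs_eq.trans[OF uv] bs_eq.trans[OF bs_eq.sym[OF uv]] by blast
qed

lemma in_bs_class: "w \<in> bs_class m n w"
  by (simp add: bs_class_def bs_eq.refl)

lemma BS_mult: "bs_class m n u \<otimes>\<^bsub>BS m n\<^esub> bs_class m n v = bs_class m n (u @ v)"
proof -
  have "bs_class m n (u' @ v') = bs_class m n (u @ v)"
    if "u' \<in> bs_class m n u" "v' \<in> bs_class m n v" for u' v'
  proof -
    have "bs_eq m n u u'" "bs_eq m n v v'"
      using that by (auto simp: bs_class_def)
    then show ?thesis
      unfolding bs_class_eq_iff by (rule bs_eq.sym[OF bs_eq.cong])
  qed
  then have "(\<Union>u'\<in>bs_class m n u. \<Union>v'\<in>bs_class m n v. bs_class m n (u' @ v')) =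
             (\<Union>u'\<in>bs_class m n u. \<Union>v'\<in>bs_class m n v. bs_class m n (u @ v))"
    by (intro SUP_cong HOL.refl)
  also have "\<dots> = bs_class m n (u @ v)"
    using in_bs_class[of u m n] in_bs_class[of v m n] by blast
  finally show ?thesis
    by (simp add: BS_def)
qed

lemma BS_one: "\<one>\<^bsub>BS m n\<^esub> = bs_class m n []"
  by (simp add: BS_def)

lemma BS_carrier: "carrier (BS m n) = range (bs_class m n)"
  by (simp add: BS_def)

lemma bs_eq_left_inv: "bs_eq m n (rev (map letter_inv w) @ w) []"
proof (induction w)
  case Nil
  show ?case by (simp add: bs_eq.refl)
next
  case (Cons x w)
  have inv: "letter_inv (letter_inv x) = x"
    by (cases x) auto
  have "bs_eq m n [letter_inv x, x] []"
    using bs_eq.cancel[of m n "letter_inv x"] inv by simp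
  from bs_eq.cong[OF bs_eq.refl[of m n "rev (map letter_inv w)"]
      bs_eq.cong[OF this bs_eq.refl[of m n w]]]
  have "bs_eq m n (rev (map letter_inv (x # w)) @ x # w) (rev (map letter_inv w) @ w)"
    by simp
  then show ?case
    using Cons.IH bs_eq.trans by blast
qed

lemma group_BS: "group (BS m n)"
proof (rule groupI)
  fix X assume "X \<in> carrier (BS m n)"
  then obtain w where w: "X = bs_class m n w"
    by (auto simp: BS_carrier)
  have "bs_class m n (rev (map letter_inv w)) \<otimes>\<^bsub>BS m n\<^esub> X = \<one>\<^bsub>BS m n\<^esub>"
    unfolding w BS_mult BS_one bs_class_eq_iff by (rule bs_eq_left_inv)
  then show "\<exists>Y\<in>carrier (BS m n). Y \<otimes>\<^bsub>BS m n\<^esub> X = \<one>\<^bsub>BS m n\<^esub>"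
    by (auto simp: BS_carrier)
qed (auto simp: BS_carrier BS_mult BS_one)


section \<open>Height, alpha and lambda\<close>

definition word_height :: "letter list \<Rightarrow> int" where
  "word_height w = int (count_list w Lb) - int (count_list w Lb_inv)"

text \<open>The recursion for alpha removes the last letter of a word, whence the reversal.\<close>

primrec rev_alpha :: "nat \<Rightarrow> nat \<Rightarrow> letter list \<Rightarrow> real" where
  "rev_alpha m n [] = 0"
| "rev_alpha m n (x # w) = rev_alpha m n w +
     (case x of La \<Rightarrow> (real n / real m) powi word_height w
              | La_inv \<Rightarrow> - ((real n / real m) powi word_height w)
              | Lb \<Rightarrow> 0
              | Lb_inv \<Rightarrow> 0)"

definition word_alpha :: "nat \<Rightarrow> nat \<Rightarrow> letter list \<Rightarrow> real" where
  "word_alpha m n w = rev_alpha m n (rev w)"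

lemma word_height_rev [simp]: "word_height (rev w) = word_height w"
  by (simp add: word_height_def)

lemma word_height_append [simp]: "word_height (u @ v) = word_height u + word_height v"
  by (simp add: word_height_def)

lemma word_alpha_simps [simp]:
  "word_alpha m n [] = 0"
  "word_alpha m n (w @ [Lb]) = word_alpha m n w"
  "word_alpha m n (w @ [Lb_inv]) = word_alpha m n w"
  "word_alpha m n (w @ [La]) = word_alpha m n w + (real n / real m) powi word_height w"
  "word_alpha m n (w @ [La_inv]) = word_alpha m n w - (real n / real m) powi word_height w"
  by (simp_all add: word_alpha_def)

text \<open>Both quantities are constant on the classes (for positive \<open>m\<close> and \<open>n\<close>, in the case of alpha;
  see \<open>BS_height_class\<close> and \<open>BS_alpha_class\<close>), so the choice of the representative is immaterial.\<close>

definition BS_height :: "letter list set \<Rightarrow> int" where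
  "BS_height g = word_height (SOME w. w \<in> g)"

definition BS_alpha :: "nat \<Rightarrow> nat \<Rightarrow> letter list set \<Rightarrow> real" where
  "BS_alpha m n g = word_alpha m n (SOME w. w \<in> g)"

definition BS_lambda :: "nat \<Rightarrow> nat \<Rightarrow> letter list set \<Rightarrow> real" where
  "BS_lambda m n g = 1 / real m * (real m / real n) powi BS_height g * BS_alpha m n g"

lemma word_height_replicate_La: "word_height (replicate k La) = 0"
  by (induction k) (auto simp: word_height_def)

lemma word_height_cong: "bs_eq m n u v \<Longrightarrow> word_height u = word_height v"
proof (induction rule: bs_eq.induct)
  case (cancel x)
  show ?case by (cases x) (auto simp: word_height_def)
next
  case relator
  show ?case
    by (simp only: word_height_append word_height_replicate_La) (simp add: word_height_def)
qed auto

lemma word_alpha_append: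
  assumes "m > 0" "n > 0"
  shows "word_alpha m n (u @ v) =
         word_alpha m n u + (real n / real m) powi word_height u * word_alpha m n v"
proof (induction v rule: rev_induct)
  case Nil
  show ?case by simp
next
  case (snoc x v)
  have "(real n / real m) powi (word_height u + word_height v) =
        (real n / real m) powi word_height u * (real n / real m) powi word_height v"
    using assms by (simp add: power_int_add)
  then show ?case
    using snoc.IH
    by (cases x) (simp_all add: append_assoc[symmetric] distrib_left right_diff_distrib
                           del: append_assoc)
qed

lemma word_alpha_replicate_La: "word_alpha m n (replicate k La) = real k"
proof (induction k)
  case (Suc k)
  have "word_alpha m n (replicate (Suc k) La) = word_alpha m n (replicate k La @ [La])"
    by (simp add: replicate_append_same)
  also have "\<dots> = real k + 1"
    by (simp only: word_alpha_simps Suc.IH word_height_replicate_La) simp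
  finally show ?case by simp
qed simp

lemma word_alpha_cong:
  assumes "m > 0" "n > 0"
  shows "bs_eq m n u v \<Longrightarrow> word_alpha m n u = word_alpha m n v"
proof (induction rule: bs_eq.induct)
  case (cong u u' v v')
  then show ?case
    using word_height_cong[OF cong.hyps(1)] by (simp add: word_alpha_append[OF assms])
next
  case (cancel x)
  show ?case
    by (cases x) (simp_all add: word_alpha_def word_height_def)
next
  case relator
  have "word_alpha m n [Lb] = 0" "word_alpha m n [Lb_inv] = 0" "word_height [Lb] = 1"
    by (simp_all add: word_alpha_def word_height_def)
  then show ?case
    using assms by (simp only: word_alpha_append[OF assms] word_alpha_replicate_La) simp
qed auto

lemma BS_height_class: "BS_height (bs_class m n w) = word_height w"
  unfolding BS_height_def
  by (rule someI2[of _ w]) (auto simp: bs_class_def bs_eq.refl dest: word_height_cong)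

lemma BS_alpha_class:
  assumes "m > 0" "n > 0"
  shows "BS_alpha m n (bs_class m n w) = word_alpha m n w"
  unfolding BS_alpha_def
  by (rule someI2[of _ w]) (auto simp: bs_class_def bs_eq.refl dest: word_alpha_cong[OF assms])


section \<open>Multiplicative systems\<close>

text \<open>A linear map defined on an interval \<open>I\<close> only is a partial function on the reals.\<close>

definition linear_on :: "real \<Rightarrow> real set \<Rightarrow> (real \<rightharpoonup> real)" where
  "linear_on q I = (\<lambda>x. Some (q * x)) |` I"

definition sys_iterates :: "(real \<rightharpoonup> real) set \<Rightarrow> nat \<Rightarrow> real \<Rightarrow> real set" where
  "sys_iterates S k x =
     {y. \<exists>fs. length fs = k \<and> set fs \<subseteq> S \<and> fold (\<lambda>f z. Option.bind z f) fs (Some x) = Some y}"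

definition periodic_point :: "(real \<rightharpoonup> real) set \<Rightarrow> real \<Rightarrow> bool" where
  "periodic_point S x \<longleftrightarrow> (\<exists>k\<ge>1. x \<in> sys_iterates S k x)"

definition immortal_point :: "(real \<rightharpoonup> real) set \<Rightarrow> real \<Rightarrow> bool" where
  "immortal_point S x \<longleftrightarrow> (\<forall>k\<ge>1. sys_iterates S k x \<noteq> {})"


section \<open>Wang tiles\<close>

text \<open>Labels of the top and bottom edges are indexed from 1, as extensional functions on
  \<open>{1..m}\<close> and \<open>{1..n}\<close>. The vertical edges have colors of a separate type.\<close>

record ('c, 'd) wang_tile =
  tile_top :: "nat \<Rightarrow> 'c"
  tile_left :: 'd
  tile_right :: 'd
  tile_bottom :: "nat \<Rightarrow> 'c"

definition wang_shift ::
  "nat \<Rightarrow> nat \<Rightarrow> ('c, 'd) wang_tile set \<Rightarrow> (letter list set \<Rightarrow> ('c, 'd) wang_tile) set" where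
  "wang_shift m n \<tau> = {T \<in> carrier (BS m n) \<rightarrow>\<^sub>E \<tau>.
     \<forall>g\<in>carrier (BS m n). \<forall>k\<in>{1..m}. \<forall>j\<in>{1..n}.
       tile_right (T g) = tile_left (T (g \<otimes>\<^bsub>BS m n\<^esub> gen_a m n [^]\<^bsub>BS m n\<^esub> m)) \<and>
       tile_top (T g) k =
         tile_bottom (T (g \<otimes>\<^bsub>BS m n\<^esub> gen_a m n [^]\<^bsub>BS m n\<^esub> (int k - int j) \<otimes>\<^bsub>BS m n\<^esub> gen_b m n)) j}"

definition mult_tile ::
  "nat \<Rightarrow> nat \<Rightarrow> real \<Rightarrow> letter list set \<Rightarrow> real \<Rightarrow> (int, real) wang_tile" where
  "mult_tile m n q g x = (let \<mu> = BS_lambda m n g in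
     \<lparr>tile_top = (\<lambda>j\<in>{1..m}. \<lfloor>(real m * \<mu> + real j) * x\<rfloor> - \<lfloor>(real m * \<mu> + real j - 1) * x\<rfloor>),
      tile_left = q / real m * of_int \<lfloor>real m * \<mu> * x\<rfloor>
                  - 1 / real n * of_int \<lfloor>real n * \<mu> * q * x\<rfloor>,
      tile_right = q / real m * of_int \<lfloor>(real m * \<mu> + real m) * x\<rfloor>
                   - 1 / real n * of_int \<lfloor>(real n * \<mu> + real n) * q * x\<rfloor>,
      tile_bottom = (\<lambda>j\<in>{1..n}. \<lfloor>(real n * \<mu> + real j) * q * x\<rfloor>
                                - \<lfloor>(real n * \<mu> + real j - 1) * q * x\<rfloor>)\<rparr>)"

definition mult_tileset :: "nat \<Rightarrow> nat \<Rightarrow> real \<Rightarrow> real set \<Rightarrow> (int, real) wang_tile set" where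
  "mult_tileset m n q I = {mult_tile m n q g x |g x. g \<in> carrier (BS m n) \<and> x \<in> I}"


section \<open>The subshift of a multiplicative system\<close>

text \<open>The index \<open>i\<close> of the map is recorded in both vertical edges; it is the color of the tile.\<close>

definition colored_tile :: "nat \<Rightarrow> ('c, 'd) wang_tile \<Rightarrow> ('c, 'd \<times> nat) wang_tile" where
  "colored_tile i s = \<lparr>tile_top = tile_top s, tile_left = (tile_left s, i),
                       tile_right = (tile_right s, i), tile_bottom = tile_bottom s\<rparr>"

definition tile_color :: "('c, 'd \<times> nat) wang_tile \<Rightarrow> nat" where
  "tile_color s = snd (tile_left s)"

definition sys_tileset ::
  "nat \<Rightarrow> nat \<Rightarrow> nat \<Rightarrow> (nat \<Rightarrow> real) \<Rightarrow> (nat \<Rightarrow> int) \<Rightarrow> (int, real \<times> nat) wang_tile set" where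
  "sys_tileset m n N q a =
     (\<Union>i\<in>{1..N}. colored_tile i ` mult_tileset m n (q i) {of_int (a i)..of_int (a i) + 1})"

definition sys_subshift ::
  "nat \<Rightarrow> nat \<Rightarrow> nat \<Rightarrow> (nat \<Rightarrow> real) \<Rightarrow> (nat \<Rightarrow> int) \<Rightarrow>
   (nat \<Rightarrow> nat) \<Rightarrow> (nat \<Rightarrow> nat) \<Rightarrow> (nat \<Rightarrow> nat) \<Rightarrow> (nat \<Rightarrow> nat) \<Rightarrow>
   (letter list set \<Rightarrow> (int, real \<times> nat) wang_tile) set" where
  "sys_subshift m n N q a d1 e1 d2 e2 =
     {T \<in> wang_shift m n (sys_tileset m n N q a).
       \<forall>g\<in>carrier (BS m n). \<forall>i. tile_color (T g) = i \<longrightarrow>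
         (let label = (\<lambda>j::int. tile_top (T (g \<otimes>\<^bsub>BS m n\<^esub> gen_a m n [^]\<^bsub>BS m n\<^esub> j)) 1) in
           \<forall>s. card {j \<in> {s..<s + int (e1 i)}. label j = a i + 1} \<ge> d1 i \<and>
               card {j \<in> {s..<s + int (e2 i)}. label j = a i} \<ge> d2 i)}"

end

theory Submission
  imports Defs "HOL-Analysis.Function_Topology"
begin

text \<open>If the labels on a line of a tiling are periodic, they have an average. The vertical colors of
  the tiles on the line of \<open>g\<close> telescope, so if \<open>T\<^sub>g\<close> has color \<open>i\<close>, the average on the line of \<open>g b\<^sup>-\<^sup>1\<close>
  is \<open>q\<^sub>i\<close> times that on the line of \<open>g\<close>, and the frequency conditions place the latter in \<open>I\<^sub>i\<close>.
  For a strongly periodic tiling the averages along the powers of \<open>b\<^sup>-\<^sup>1\<close> come back to their starting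
  value, which is then a periodic point. Conversely, an immortal point yields, by compactness, a
  two-sided orbit \<open>(x\<^sub>k)\<close>, and the tiles with parameter \<open>x\<^sub>k\<close> placed at height \<open>- k\<close> form a tiling
  whose lines carry the Sturmian words of slope \<open>x\<^sub>k\<close>.\<close>

section \<open>Configurations on a group\<close>

text \<open>A finite orbit leaves finitely many translates of \<open>T\<close>, and right
  multiplication by \<open>x\<close> acts on them as a map. Two of its powers coincide; cancelling
  the smaller one gives a period valid at every \<open>g\<close> and in front of every
  \<open>h\<close>, so a single \<open>p\<close> serves all lines of a tiling.\<close>

lemma (in group) strongly_periodic_uniform_period:
  assumes per: "strongly_periodic G T" and x: "x \<in> carrier G"
  obtains p :: nat where "p > 0"
    and "\<And>g h. g \<in> carrier G \<Longrightarrow> h \<in> carrier G \<Longrightarrow> T (g \<otimes> x [^] p \<otimes> h) = T (g \<otimes> h)"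
proof -
  define F where "F g = (\<lambda>h\<in>carrier G. T (g \<otimes> h))" for g
  have F: "F g \<in> (\<lambda>g. shift_action G g T) ` carrier G" if "g \<in> carrier G" for g
    using that by (auto simp: F_def shift_action_def intro!: image_eqI[of _ _ "inv g"])
  have F_right: "F (g \<otimes> y) = F (g' \<otimes> y)"
    if "F g = F g'" "g \<in> carrier G" "g' \<in> carrier G" "y \<in> carrier G" for g g' y
  proof
    fix h
    show "F (g \<otimes> y) h = F (g' \<otimes> y) h"
      using fun_cong[OF that(1), of "y \<otimes> h"] that(2-) by (auto simp: F_def m_assoc restrict_def)
  qed
  let ?R = "(\<lambda>g. shift_action G g T) ` carrier G"
  \<comment> \<open>This is the graph of the map that the \<open>k\<close>-th power of
    \<open>x\<close> induces on the translates; \<open>F_right\<close> makes it single-valued. As a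
    subset of the finite \<open>?R \<times> ?R\<close>, it must repeat for two exponents.\<close>
  define graph where "graph k = (\<lambda>g. (F g, F (g \<otimes> x [^] k))) ` carrier G" for k :: nat
  have "range graph \<subseteq> Pow (?R \<times> ?R)"
    using F x by (auto simp: graph_def simp del: image_iff)
  moreover have "finite ?R"
    using per by (simp add: strongly_periodic_def)
  ultimately have "finite (range graph)"
    using finite_subset[of "range graph" "Pow (?R \<times> ?R)"] by blast
  then have "\<not> inj graph"
    using finite_imageD by blast
  then obtain k l where kl: "k < l" "graph k = graph l"
    unfolding inj_def by (metis linorder_neqE_nat)
  have eq: "F (g \<otimes> x [^] k) = F (g \<otimes> x [^] l)" if g: "g \<in> carrier G" for g
  proof -
    have "(F g, F (g \<otimes> x [^] k)) \<in> graph l"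
      using g kl(2) by (auto simp: graph_def)
    then obtain g' where "g' \<in> carrier G" "F g = F g'" "F (g \<otimes> x [^] k) = F (g' \<otimes> x [^] l)"
      by (auto simp: graph_def)
    then show ?thesis
      using F_right[of g g' "x [^] l"] g x by simp
  qed
  have "T (g \<otimes> x [^] (l - k) \<otimes> h) = T (g \<otimes> h)"
    if g: "g \<in> carrier G" and h: "h \<in> carrier G" for g h
  proof -
    have l: "x [^] l = x [^] k \<otimes> x [^] (l - k)"
      using kl(1) x by (simp add: nat_pow_mult)
    have "F g = F (g \<otimes> inv (x [^] k) \<otimes> x [^] k)"
      using g x by (simp add: m_assoc)
    also have "\<dots> = F (g \<otimes> inv (x [^] k) \<otimes> x [^] l)"
      using g x by (intro eq) simp
    also have "\<dots> = F (g \<otimes> x [^] (l - k))"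
      unfolding l using g x by (simp add: m_assoc[symmetric]) (simp add: m_assoc)
    finally show ?thesis
      using h by (auto simp: F_def dest: fun_cong[of _ _ h])
  qed
  then show thesis
    using kl(1) by (intro that[of "l - k"]) auto
qed

text \<open>The forbidden patterns are those on the window \<open>W\<close> that violate
  \<open>P\<close>; there are finitely many since \<open>A\<close> and \<open>W\<close> are finite.
  The function \<open>\<lambda>h. x (g \<otimes> h)\<close> is the configuration as seen from
  \<open>g\<close>.\<close>

lemma (in group) is_SFT_local:
  assumes A: "finite A" and W: "finite W" "W \<subseteq> carrier G"
    and local: "\<And>x y. (\<And>h. h \<in> W \<Longrightarrow> x h = y h) \<Longrightarrow> P x \<Longrightarrow> P y"
  shows "is_SFT G A {x \<in> carrier G \<rightarrow>\<^sub>E A. \<forall>g\<in>carrier G. P (\<lambda>h. x (g \<otimes> h))}"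
proof -
  \<comment> \<open>Off \<open>W\<close>, the value \<open>the None\<close> stands in for the
    missing symbols; by \<open>local\<close>, \<open>P\<close> sees only \<open>W\<close>.\<close>
  define F where "F = {p. dom p = W \<and> ran p \<subseteq> A \<and> \<not> P (\<lambda>h. the (p h))}"
  have "finite F"
    using finite_set_of_finite_maps[OF W(1) A] by (rule rev_finite_subset) (auto simp: F_def)
  moreover have "(\<forall>p\<in>F. \<not> appears_in G p x) \<longleftrightarrow> (\<forall>g\<in>carrier G. P (\<lambda>h. x (g \<otimes> h)))"
    if x: "x \<in> carrier G \<rightarrow>\<^sub>E A" for x
  proof (intro iffI ballI)
    fix g assume *: "\<forall>p\<in>F. \<not> appears_in G p x" and g: "g \<in> carrier G"
    define p where "p = (\<lambda>h. if h \<in> W then Some (x (g \<otimes> h)) else None)"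
    have "dom p = W" "ran p \<subseteq> A"
      using x g W(2) by (auto simp: p_def dom_def ran_def split: if_splits)
    moreover have "appears_in G p x"
      using g unfolding appears_in_def by (intro bexI[of _ g]) (auto simp: p_def split: if_splits)
    ultimately have "P (\<lambda>h. the (p h))"
      using * by (auto simp: F_def)
    then show "P (\<lambda>h. x (g \<otimes> h))"
      by (rule local[rotated]) (simp add: p_def)
  next
    fix p assume *: "\<forall>g\<in>carrier G. P (\<lambda>h. x (g \<otimes> h))" and p: "p \<in> F"
    show "\<not> appears_in G p x"
    proof
      assume "appears_in G p x"
      then obtain g where g: "g \<in> carrier G" "\<And>h. h \<in> W \<Longrightarrow> p h = Some (x (g \<otimes> h))"
        using p by (auto simp: appears_in_def F_def)
      have "P (\<lambda>h. the (p h))"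
        using * g(1) by (rule_tac local[of "\<lambda>h. x (g \<otimes> h)"]) (auto simp: g(2))
      then show False
        using p by (simp add: F_def)
    qed
  qed
  ultimately show ?thesis
    unfolding is_SFT_def using A W by (intro conjI exI[of _ F]) (auto simp: F_def)
qed


section \<open>Orbits of multiplicative systems\<close>

lemma sys_iterates_Suc:
  "y \<in> sys_iterates S (Suc k) x \<longleftrightarrow> (\<exists>w\<in>sys_iterates S k x. \<exists>f\<in>S. f w = Some y)"
proof
  assume "y \<in> sys_iterates S (Suc k) x"
  then obtain fs where fs: "length fs = Suc k" "set fs \<subseteq> S"
    "fold (\<lambda>f z. Option.bind z f) fs (Some x) = Some y"
    by (auto simp: sys_iterates_def)
  then obtain gs f where "fs = gs @ [f]"
    by (metis append_butlast_last_id list.size(3) nat.distinct(1))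
  with fs show "\<exists>w\<in>sys_iterates S k x. \<exists>f\<in>S. f w = Some y"
    by (auto simp: sys_iterates_def bind_eq_Some_conv)
next
  assume "\<exists>w\<in>sys_iterates S k x. \<exists>f\<in>S. f w = Some y"
  then obtain w f fs where "f \<in> S" "f w = Some y" "length fs = k" "set fs \<subseteq> S"
    "fold (\<lambda>f z. Option.bind z f) fs (Some x) = Some w"
    by (auto simp: sys_iterates_def)
  then show "y \<in> sys_iterates S (Suc k) x"
    by (auto simp: sys_iterates_def intro!: exI[of _ "fs @ [f]"])
qed

text \<open>This trades chains of partial maps for an explicit orbit \<open>z\<close> with choices
  \<open>c\<close>: averages of a periodic tiling produce such data, and the compactness argument
  consumes it.\<close>

lemma sys_iterates_linear_iff:
  "y \<in> sys_iterates ((\<lambda>i. linear_on (q i) (I i)) ` C) k x \<longleftrightarrow>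
    (\<exists>c z. z 0 = x \<and> z k = y \<and> (\<forall>j<k. c j \<in> C \<and> z j \<in> I (c j) \<and> z (Suc j) = q (c j) * z j))"
proof (induction k arbitrary: y)
  case 0
  show ?case by (auto simp: sys_iterates_def intro!: exI[of _ "\<lambda>_. x"])
next
  case (Suc k)
  show ?case (is "_ \<longleftrightarrow> ?R")
  proof
    assume "y \<in> sys_iterates ((\<lambda>i. linear_on (q i) (I i)) ` C) (Suc k) x"
    then obtain w i where w: "w \<in> sys_iterates ((\<lambda>i. linear_on (q i) (I i)) ` C) k x"
      and i: "i \<in> C" "w \<in> I i" "y = q i * w"
      by (auto simp: sys_iterates_Suc linear_on_def restrict_map_def split: if_splits)
    then obtain c z where cz: "z 0 = x" "z k = w"
      "\<forall>j<k. c j \<in> C \<and> z j \<in> I (c j) \<and> z (Suc j) = q (c j) * z j"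
      unfolding Suc.IH by blast
    show ?R
      using i cz
      by (intro exI[of _ "c(k := i)"] exI[of _ "z(Suc k := y)"]) (auto simp: less_Suc_eq)
  next
    assume ?R
    then obtain c z where cz: "z 0 = x" "z (Suc k) = y"
      "\<forall>j<Suc k. c j \<in> C \<and> z j \<in> I (c j) \<and> z (Suc j) = q (c j) * z j"
      by blast
    have "z k \<in> sys_iterates ((\<lambda>i. linear_on (q i) (I i)) ` C) k x"
      unfolding Suc.IH using cz by (intro exI[of _ c] exI[of _ z]) auto
    moreover have "linear_on (q (c k)) (I (c k)) (z k) = Some y" "c k \<in> C"
      using cz by (auto simp: linear_on_def)
    ultimately show "y \<in> sys_iterates ((\<lambda>i. linear_on (q i) (I i)) ` C) (Suc k) x"
      unfolding sys_iterates_Suc by blast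
  qed
qed

text \<open>Upwards, the tiling needs preimages of every point, so a forward orbit does not suffice;
  a two-sided orbit is a limit of recentered segments of forward orbits.\<close>

lemma immortal_point_two_sided_orbit:
  fixes q :: "nat \<Rightarrow> real"
  assumes fin: "finite C" and cpt: "\<And>i. i \<in> C \<Longrightarrow> compact (I i)"
    and imm: "immortal_point ((\<lambda>i. linear_on (q i) (I i)) ` C) x"
  shows "\<exists>c z. \<forall>k::int. c k \<in> C \<and> z k \<in> I (c k) \<and> z (k + 1) = q (c k) * z k"
proof -
  define Z where "Z = (\<Union>i\<in>C. {i} \<times> I i)"
  \<comment> \<open>Two-sided orbits are the points of a product of copies of the compact
    \<open>Z\<close> that lie in every closed set \<open>D k\<close>, so the finite intersection
    property leaves finitely many \<open>k\<close> to satisfy at once.\<close>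
  define D where "D k = {w :: int \<Rightarrow> nat \<times> real. snd (w (k + 1)) = q (fst (w k)) * snd (w k)}" for k
  have "compact Z"
    unfolding Z_def using fin cpt by (intro compact_UN compact_Times) auto
  then have "compactin (product_topology (\<lambda>_::int. euclidean) UNIV) (PiE UNIV (\<lambda>_. Z))"
    by (simp add: compactin_PiE)
  then have X: "compact (PiE UNIV (\<lambda>_::int. Z))"
    by (simp add: euclidean_product_topology)
  have "PiE UNIV (\<lambda>_. Z) \<inter> (\<Inter>k\<in>UNIV. D k) \<noteq> {}"
  proof (rule compact_imp_fip_image[OF X])
    fix k
    \<comment> \<open>Indices of maps carry the discrete topology, so the chosen slope depends
      continuously on \<open>w\<close>.\<close>
    have "continuous_on UNIV (\<lambda>w :: int \<Rightarrow> nat \<times> real. q (fst (w k)))"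
      by (rule continuous_on_compose2[OF continuous_on_discrete[of UNIV q]])
        (auto intro!: continuous_intros)
    then show "closed (D k)"
      unfolding D_def by (intro closed_Collect_eq continuous_intros) auto
  next
    fix K :: "int set" assume "finite K"
    define B where "B = nat (Max (insert 0 (abs ` K)))"
    have B: "\<bar>k\<bar> \<le> int B" if "k \<in> K" for k
      using \<open>finite K\<close> that Max_ge[of "insert 0 (abs ` K)" "\<bar>k\<bar>"] by (simp add: B_def)
    obtain y where "y \<in> sys_iterates ((\<lambda>i. linear_on (q i) (I i)) ` C) (2 * B + 2) x"
      using imm unfolding immortal_point_def by (metis ex_in_conv le_add2 one_le_numeral order_trans)
    then obtain c z where cz:
      "\<And>j. j < 2 * B + 2 \<Longrightarrow> c j \<in> C \<and> z j \<in> I (c j) \<and> z (Suc j) = q (c j) * z j"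
      unfolding sys_iterates_linear_iff by blast
    \<comment> \<open>Position \<open>- B\<close> holds the start of the forward orbit, so positions
      up to \<open>B + 1\<close> use indices up to \<open>2 * B + 1\<close>. For \<open>k\<close> in
      \<open>K\<close> both \<open>k\<close> and \<open>k + 1\<close> fall in this range; elsewhere
      the pair at index 0 keeps \<open>w\<close> inside \<open>Z\<close>.\<close>
    define w where "w k = (let j = (if \<bar>k\<bar> \<le> int B + 1 then nat (k + int B) else 0) in (c j, z j))"
      for k :: int
    have "w k \<in> Z" for k
      using cz[of "if \<bar>k\<bar> \<le> int B + 1 then nat (k + int B) else 0"] by (auto simp: w_def Z_def Let_def)
    moreover have "w \<in> D k" if "k \<in> K" for k
      using B[OF that] cz[of "nat (k + int B)"]
      by (auto simp: D_def w_def Let_def Suc_nat_eq_nat_zadd1 algebra_simps)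
    ultimately show "PiE UNIV (\<lambda>_. Z) \<inter> (\<Inter>k\<in>K. D k) \<noteq> {}"
      by (intro ex_in_conv[THEN iffD1] exI[of _ w]) auto
  qed
  then obtain w where w: "\<And>k. w k \<in> Z" "\<And>k. w \<in> D k"
    by auto
  have "fst (w k) \<in> C \<and> snd (w k) \<in> I (fst (w k))" for k
    using w(1)[of k] by (auto simp: Z_def)
  moreover have "snd (w (k + 1)) = q (fst (w k)) * snd (w k)" for k
    using w(2)[of k] by (simp add: D_def)
  ultimately show ?thesis
    by (intro exI[of _ "\<lambda>k. fst (w k)"] exI[of _ "\<lambda>k. snd (w k)"]) auto
qed


section \<open>Words over two consecutive integers\<close>

lemma card_window:
  fixes s :: int
  shows "card {j \<in> {s..<s + int e}. P j} = (\<Sum>j<e. of_bool (P (s + int j)))"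
proof -
  have "{j \<in> {s..<s + int e}. P j} = (\<lambda>j. s + int j) ` {j. j < e \<and> P (s + int j)}"
    by (auto intro!: image_eqI[of _ _ "nat (_ - s)"])
  then have "card {j \<in> {s..<s + int e}. P j} = card {j. j < e \<and> P (s + int j)}"
    by (simp add: card_image inj_on_def)
  also have "\<dots> = (\<Sum>j<e. of_bool (P (s + int j)))"
    by (simp add: of_bool_def sum.If_cases Int_def)
  finally show ?thesis .
qed

text \<open>Occurrences of \<open>a + 1\<close> are the excess of the sum over \<open>e * a\<close>,
  occurrences of \<open>a\<close> its deficit from \<open>e * (a + 1)\<close>. Frequency conditions
  thereby become bounds on sums.\<close>

lemma window_sum:
  fixes f :: "int \<Rightarrow> int" and e :: nat
  assumes "\<And>j. f j = a \<or> f j = a + 1"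
  shows "(\<Sum>j<e. f (s + int j)) = int e * a + int (card {j \<in> {s..<s + int e}. f j = a + 1})"
    and "(\<Sum>j<e. f (s + int j)) = int e * (a + 1) - int (card {j \<in> {s..<s + int e}. f j = a})"
proof -
  have "f j = a + of_bool (f j = a + 1)" "f j = (a + 1) - of_bool (f j = a)" for j
    using assms[of j] by auto
  then have "(\<Sum>j<e. f (s + int j)) = (\<Sum>j<e. a + of_bool (f (s + int j) = a + 1))"
    "(\<Sum>j<e. f (s + int j)) = (\<Sum>j<e. (a + 1) - of_bool (f (s + int j) = a))"
    by (metis (no_types))+
  then show "(\<Sum>j<e. f (s + int j)) = int e * a + int (card {j \<in> {s..<s + int e}. f j = a + 1})"
    "(\<Sum>j<e. f (s + int j)) = int e * (a + 1) - int (card {j \<in> {s..<s + int e}. f j = a})"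
    unfolding card_window sum.distrib sum_subtractf by (simp_all add: distrib_left)
qed

lemma sum_blocks:
  fixes f :: "nat \<Rightarrow> 'a :: comm_monoid_add"
  shows "(\<Sum>j<k * n. f j) = (\<Sum>t<k. \<Sum>j<n. f (t * n + j))"
proof -
  have "sum f {t * n..<t * n + n} = (\<Sum>j<n. f (t * n + j))" for t
    using sum.shift_bounds_nat_ivl[of f 0 "t * n" n] by (simp add: add.commute atLeast0LessThan)
  then show ?thesis
    by (simp flip: sum.nat_group)
qed

lemma sum_periodic:
  fixes f :: "nat \<Rightarrow> 'a :: semiring_1"
  assumes "\<And>j. f (j + P) = f j"
  shows "(\<Sum>j<k * P. f j) = of_nat k * (\<Sum>j<P. f j)"
proof -
  have "f (t * P + j) = f j" for t j
    using assms by (induction t) (simp_all add: algebra_simps, metis add.commute add.left_commute)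
  then show ?thesis
    by (simp add: sum_blocks)
qed

text \<open>A stretch of \<open>e * P\<close> positions consists of \<open>P\<close> windows of
  length \<open>e\<close> and also of \<open>e\<close> periods. Adding the bounds for the windows
  therefore bounds the mean over one period.\<close>

lemma periodic_window_density:
  fixes f :: "int \<Rightarrow> int" and e P :: nat
  assumes f: "\<And>j. f j = a \<or> f j = a + 1" and per: "\<And>j. f (j + int P) = f j"
    and "P > 0" "e > 0"
  shows "(\<And>s. d \<le> card {j \<in> {s..<s + int e}. f j = a + 1}) \<Longrightarrow>
           real_of_int a + real d / real e \<le> real_of_int (\<Sum>j<P. f (int j)) / real P"
    and "(\<And>s. d \<le> card {j \<in> {s..<s + int e}. f j = a}) \<Longrightarrow>
           real_of_int (\<Sum>j<P. f (int j)) / real P \<le> real_of_int a + 1 - real d / real e"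
proof -
  have per': "f (int (j + P)) = f (int j)" for j
    using per[of "int j"] by simp
  have sum: "int e * (\<Sum>j<P. f (int j)) = (\<Sum>t<P. \<Sum>j<e. f (int (t * e) + int j))"
    using sum_periodic[of "\<lambda>j. f (int j)" P e, OF per'] sum_blocks[of "\<lambda>j. f (int j)" P e]
    by (simp add: mult.commute)
  {
    assume d: "\<And>s. d \<le> card {j \<in> {s..<s + int e}. f j = a + 1}"
    have "int P * (int e * a + int d) = (\<Sum>t<P. int e * a + int d)"
      by simp
    also have "\<dots> \<le> int e * (\<Sum>j<P. f (int j))"
      unfolding sum by (rule sum_mono) (use d window_sum(1)[of f a, OF f] in simp)
    finally have "real P * (real e * real_of_int a + real d) \<le> real e * real_of_int (\<Sum>j<P. f (int j))"
      by (metis (no_types, lifting) of_int_add of_int_le_iff of_int_mult of_int_of_nat_eq)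
    then show "real_of_int a + real d / real e \<le> real_of_int (\<Sum>j<P. f (int j)) / real P"
      using assms(3,4) by (simp add: field_simps)
  next
    assume d: "\<And>s. d \<le> card {j \<in> {s..<s + int e}. f j = a}"
    have "int e * (\<Sum>j<P. f (int j)) \<le> (\<Sum>t<P. int e * (a + 1) - int d)"
      unfolding sum by (rule sum_mono) (use d window_sum(2)[of f a, OF f] in simp)
    also have "\<dots> = int P * (int e * (a + 1) - int d)"
      by simp
    finally have "real e * real_of_int (\<Sum>j<P. f (int j)) \<le> real P * (real e * (real_of_int a + 1) - real d)"
      by (metis (no_types, lifting) of_int_add of_int_diff of_int_1 of_int_le_iff of_int_mult of_int_of_nat_eq)
    then show "real_of_int (\<Sum>j<P. f (int j)) / real P \<le> real_of_int a + 1 - real d / real e"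
      using assms(3,4) by (simp add: field_simps)
  }
qed

lemma floor_add_cases:
  fixes x :: real
  assumes "of_int a \<le> x" "x \<le> of_int a + 1"
  shows "\<lfloor>u + x\<rfloor> - \<lfloor>u\<rfloor> = a \<or> \<lfloor>u + x\<rfloor> - \<lfloor>u\<rfloor> = a + 1"
  using assms by linarith


section \<open>The group\<close>

locale baumslag_solitar =
  fixes m n :: nat
  assumes m_pos: "m > 0" and n_pos: "n > 0"
begin

sublocale group "BS m n"
  by (rule group_BS)

abbreviation G where "G \<equiv> BS m n"
abbreviation prod_G (infixl "\<cdot>" 70) where "g \<cdot> h \<equiv> g \<otimes>\<^bsub>G\<^esub> h"
abbreviation A :: "int \<Rightarrow> letter list set" where "A j \<equiv> gen_a m n [^]\<^bsub>G\<^esub> j"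
abbreviation b where "b \<equiv> gen_b m n"
abbreviation b_inv where "b_inv \<equiv> inv\<^bsub>G\<^esub> b"

lemma gens_closed [simp]: "gen_a m n \<in> carrier G" "b \<in> carrier G"
  by (auto simp: BS_carrier)

lemma A_add: "A i \<cdot> A j = A (i + j)"
  by (simp add: int_pow_mult)

lemma mult_A_A: "g \<in> carrier G \<Longrightarrow> g \<cdot> A i \<cdot> A j = g \<cdot> A (i + j)"
  by (simp add: m_assoc A_add)

lemma A_of_nat: "A (int k) = bs_class m n (replicate k La)"
proof (induction k)
  case 0
  show ?case by (simp add: BS_one)
next
  case (Suc k)
  have "A (int (Suc k)) = A (int k) \<cdot> gen_a m n"
    by (simp add: int_pow_int del: of_nat_Suc)
  then show ?case
    by (simp add: Suc.IH BS_mult replicate_append_same)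
qed

text \<open>The relator solved for the step down: \<open>m\<close> steps on a line match
  \<open>n\<close> steps on the line reached by \<open>b_inv\<close>.\<close>

lemma A_m_b_inv: "A (int m) \<cdot> b_inv = b_inv \<cdot> A (int n)"
proof -
  have "b \<cdot> bs_class m n [Lb_inv] = \<one>\<^bsub>G\<^esub>"
    using bs_eq.cancel[of m n Lb] by (simp add: BS_mult BS_one bs_class_eq_iff)
  then have b_inv: "b_inv = bs_class m n [Lb_inv]"
    by (intro inv_equality[OF inv_comm]) (auto simp: BS_carrier)
  have "b \<cdot> (A (int m) \<cdot> b_inv) = A (int n)"
    using bs_eq.relator[of m n] by (simp add: b_inv A_of_nat BS_mult bs_class_eq_iff)
  then show ?thesis
    by (simp add: inv_solve_left)
qed

lemma A_mult_m_b_inv: "A (int (i * m)) \<cdot> b_inv = b_inv \<cdot> A (int (i * n))"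
proof (induction i)
  case 0
  show ?case by simp
next
  case (Suc i)
  have "A (int (Suc i * m)) \<cdot> b_inv = A (int (i * m)) \<cdot> (A (int m) \<cdot> b_inv)"
    by (simp add: A_add add.commute flip: m_assoc)
  also have "\<dots> = b_inv \<cdot> (A (int (i * n)) \<cdot> A (int n))"
    by (simp add: A_m_b_inv Suc.IH del: of_nat_mult flip: m_assoc)
  finally show ?case
    by (simp add: A_add add.commute)
qed

section \<open>Height, alpha and lambda under multiplication by the generators\<close>

lemma height_mult:
  "g \<in> carrier G \<Longrightarrow> h \<in> carrier G \<Longrightarrow> BS_height (g \<cdot> h) = BS_height g + BS_height h"
  by (auto simp: BS_carrier BS_mult BS_height_class)

lemma alpha_mult:
  "g \<in> carrier G \<Longrightarrow> h \<in> carrier G \<Longrightarrow>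
    BS_alpha m n (g \<cdot> h) = BS_alpha m n g + (real n / real m) powi BS_height g * BS_alpha m n h"
  using m_pos n_pos
  by (auto simp: BS_carrier BS_mult BS_height_class BS_alpha_class word_alpha_append)

lemma height_alpha_gens:
  "BS_height (gen_a m n) = 0" "BS_alpha m n (gen_a m n) = 1" "BS_height b = 1" "BS_alpha m n b = 0"
  using m_pos n_pos
  by (simp_all add: BS_height_class BS_alpha_class word_height_def word_alpha_def)

lemma height_alpha_A: "BS_height (A j) = 0 \<and> BS_alpha m n (A j) = of_int j"
proof -
  have step: "BS_height (A (i + 1)) = BS_height (A i) \<and>
      BS_alpha m n (A (i + 1)) = BS_alpha m n (A i) + (real n / real m) powi BS_height (A i)" for i
    using height_mult[of "A i" "gen_a m n"] alpha_mult[of "A i" "gen_a m n"] A_add[of i 1]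
    by (simp add: height_alpha_gens)
  show ?thesis
  proof (induction j rule: int_induct[where k = 0])
    case base
    show ?case
      using m_pos n_pos by (simp add: BS_one BS_height_class BS_alpha_class word_height_def)
  next
    case (step1 i)
    then show ?case using step[of i] by simp
  next
    case (step2 i)
    then show ?case using step[of "i - 1"] by simp
  qed
qed

lemma height_mult_A [simp]: "g \<in> carrier G \<Longrightarrow> BS_height (g \<cdot> A j) = BS_height g"
  by (simp add: height_mult height_alpha_A)

lemma power_scale_cancel: "(real m / real n) powi h * (real n / real m) powi h = 1"
proof -
  have "(real m / real n) powi h * (real n / real m) powi h = 1 powi h"
    using m_pos n_pos by (simp flip: power_int_mult_distrib)
  then show ?thesis by simp
qed

text \<open>Alpha weights a step by a power of \<open>n / m\<close> that depends on the height; the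
  prefactor in lambda cancels it, so positions on every line are unit-spaced.\<close>

lemma lambda_mult_A:
  assumes "g \<in> carrier G"
  shows "real m * BS_lambda m n (g \<cdot> A j) = real m * BS_lambda m n g + of_int j"
  using assms m_pos power_scale_cancel[of "BS_height g"]
  by (simp add: BS_lambda_def alpha_mult height_alpha_A distrib_left mult.assoc[symmetric])

text \<open>A final \<open>b\<close> keeps alpha and raises the height by one, which multiplies
  lambda by \<open>m / n\<close>. Hence tops and bottoms that are glued together use the same
  position.\<close>

lemma lambda_mult_A_b:
  assumes "g \<in> carrier G"
  shows "real n * BS_lambda m n (g \<cdot> A j \<cdot> b) = real m * BS_lambda m n g + of_int j"
proof -
  have "real n * BS_lambda m n (g \<cdot> A j \<cdot> b) = real m * BS_lambda m n (g \<cdot> A j)"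
    using assms m_pos n_pos
    by (simp add: BS_lambda_def alpha_mult height_mult height_alpha_A height_alpha_gens
        power_int_add)
  then show ?thesis
    using assms by (simp add: lambda_mult_A)
qed

end


section \<open>The tiles\<close>

lemma sum_floor_differences:
  "(\<Sum>k=1..m. \<lfloor>(c + real k) * x\<rfloor> - \<lfloor>(c + real k - 1) * x\<rfloor>) = \<lfloor>(c + real m) * x\<rfloor> - \<lfloor>c * x\<rfloor>"
  by (induction m) (simp_all add: add.commute add.left_commute)

text \<open>The label sums telescope to the floors that occur in the vertical colors. So a tile
  multiplies the mean of its tops by \<open>q\<close> to get the mean of its bottoms, up to the
  difference of the carries.\<close>

lemma mult_tile_balance:
  "tile_right (mult_tile m n q g x) - tile_left (mult_tile m n q g x) =
    q / real m * of_int (\<Sum>k=1..m. tile_top (mult_tile m n q g x) k) -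
    1 / real n * of_int (\<Sum>j=1..n. tile_bottom (mult_tile m n q g x) j)"
proof -
  have "(\<Sum>k=1..m. tile_top (mult_tile m n q g x) k) =
      \<lfloor>(real m * BS_lambda m n g + real m) * x\<rfloor> - \<lfloor>real m * BS_lambda m n g * x\<rfloor>"
    using sum_floor_differences[where c = "real m * BS_lambda m n g" and x = x]
    by (simp add: mult_tile_def Let_def)
  moreover have "(\<Sum>j=1..n. tile_bottom (mult_tile m n q g x) j) =
      \<lfloor>(real n * BS_lambda m n g + real n) * (q * x)\<rfloor> - \<lfloor>real n * BS_lambda m n g * (q * x)\<rfloor>"
    using sum_floor_differences[where c = "real n * BS_lambda m n g" and x = "q * x"]
    by (simp add: mult_tile_def Let_def mult.assoc)
  ultimately show ?thesis
    by (simp add: mult_tile_def Let_def right_diff_distrib mult.assoc)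
qed

lemma mult_tile_top_cases:
  assumes "x \<in> {of_int a..of_int a + 1}" "k \<in> {1..m}"
  shows "tile_top (mult_tile m n q g x) k = a \<or> tile_top (mult_tile m n q g x) k = a + 1"
  using floor_add_cases[of a x "(real m * BS_lambda m n g + real k - 1) * x"] assms
  by (simp add: mult_tile_def Let_def algebra_simps)

section \<open>Finiteness of the tilesets\<close>

lemma finite_carries:
  assumes "m > 0" "n > 0" "q \<in> \<rat>"
  shows "finite {q / real m * of_int \<lfloor>real m * \<mu> * x\<rfloor> -
    1 / real n * of_int \<lfloor>real n * \<mu> * q * x\<rfloor> |\<mu> x. True}"
proof -
  from \<open>q \<in> \<rat>\<close> obtain u v :: int where v: "v > 0" "q = of_int u / of_int v"
    by (rule Rats_cases') auto
  define D where "D = of_int v * real m * real n"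
  have D: "D > 0" using v assms by (simp add: D_def)
  define B where "B = \<lceil>D * (\<bar>q\<bar> / real m + 1 / real n)\<rceil>"
  have "\<exists>z\<in>{-B..B}. q / real m * of_int \<lfloor>real m * \<mu> * x\<rfloor> -
      1 / real n * of_int \<lfloor>real n * \<mu> * q * x\<rfloor> = of_int z / D"
    (is "\<exists>z\<in>_. ?c = _") for \<mu> x
  proof -
    \<comment> \<open>The numerator of the carry over the common denominator \<open>D\<close>;
      boundedness then leaves finitely many values.\<close>
    define z where "z = u * int n * \<lfloor>real m * \<mu> * x\<rfloor> - v * int m * \<lfloor>real n * \<mu> * q * x\<rfloor>"
    have z: "?c = of_int z / D"
      using assms v by (simp add: z_def D_def field_simps)
    \<comment> \<open>Without the floors both terms equal \<open>q * \<mu> * x\<close> and cancel,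
      which leaves only fractional parts.\<close>
    have "?c = 1 / real n * frac (real n * \<mu> * q * x) - q / real m * frac (real m * \<mu> * x)"
      using assms by (simp add: frac_def field_simps)
    moreover have "\<bar>q / real m * frac (real m * \<mu> * x)\<bar> \<le> \<bar>q\<bar> / real m"
      using frac_lt_1[of "real m * \<mu> * x"] frac_ge_0[of "real m * \<mu> * x"] assms(1)
      by (simp add: abs_mult divide_right_mono mult_left_le)
    moreover have "\<bar>1 / real n * frac (real n * \<mu> * q * x)\<bar> \<le> 1 / real n"
      using frac_lt_1[of "real n * \<mu> * q * x"] frac_ge_0[of "real n * \<mu> * q * x"] assms(2)
      by (simp add: abs_mult divide_right_mono)
    ultimately have "\<bar>?c\<bar> \<le> \<bar>q\<bar> / real m + 1 / real n"
      by linarith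
    then have "\<bar>of_int z\<bar> \<le> D * (\<bar>q\<bar> / real m + 1 / real n)"
      using D unfolding z by (simp add: divide_le_eq mult.commute)
    then have "\<bar>z\<bar> \<le> B"
      unfolding B_def by linarith
    then show ?thesis
      using z by (intro bexI[of _ z]) auto
  qed
  then show ?thesis
    by (intro finite_subset[OF _ finite_imageI[of "{-B..B}" "\<lambda>z. of_int z / D"]]) (auto simp: image_iff)
qed

lemma finite_mult_tileset:
  assumes "m > 0" "n > 0" "q \<in> \<rat>"
  shows "finite (mult_tileset m n q {of_int a..of_int a + 1})"
proof -
  define Lr where "Lr = {q / real m * of_int \<lfloor>real m * \<mu> * x\<rfloor> -
    1 / real n * of_int \<lfloor>real n * \<mu> * q * x\<rfloor> |\<mu> x. True}"
  define B where "B = \<lceil>\<bar>q\<bar> * (\<bar>of_int a\<bar> + 1)\<rceil> + 1"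
  define U where "U = (PiE {1..m} (\<lambda>_. {a, a + 1})) \<times> Lr \<times> Lr \<times> PiE {1..n} (\<lambda>_. {-B..B})"
  define mk :: "_ \<Rightarrow> (int, real) wang_tile" where
    "mk = (\<lambda>(t, l, r, b). \<lparr>tile_top = t, tile_left = l, tile_right = r, tile_bottom = b\<rparr>)"
  have "finite Lr"
    unfolding Lr_def by (rule finite_carries[OF assms])
  then have "finite (mk ` U)"
    by (auto simp: U_def intro!: finite_cartesian_product finite_PiE)
  have "mult_tile m n q g x \<in> mk ` U"
    if x: "x \<in> {of_int a..of_int a + 1}" for g x
  proof -
    let ?s = "mult_tile m n q g x"
    have "tile_top ?s \<in> PiE {1..m} (\<lambda>_. {a, a + 1})"
      using mult_tile_top_cases[OF x, where m = m and n = n and q = q and g = g]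
      by (auto simp: PiE_iff) (simp add: mult_tile_def Let_def)
    moreover have "tile_left ?s \<in> Lr"
      unfolding Lr_def mult_tile_def Let_def by auto
    moreover have "tile_right ?s \<in> Lr"
    proof -
      \<comment> \<open>The right color has the form of a left color with lambda increased by
        one.\<close>
      have "real m * BS_lambda m n g + real m = real m * (BS_lambda m n g + 1)"
        "real n * BS_lambda m n g + real n = real n * (BS_lambda m n g + 1)"
        by (simp_all add: distrib_left)
      then show ?thesis
        unfolding Lr_def mult_tile_def Let_def by auto
    qed
    moreover have "tile_bottom ?s \<in> PiE {1..n} (\<lambda>_. {-B..B})"
    proof -
      have "\<bar>q * x\<bar> \<le> \<bar>q\<bar> * (\<bar>of_int a\<bar> + 1)"
        unfolding abs_mult using x by (intro mult_left_mono) auto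
      then have "\<bar>\<lfloor>c + q * x\<rfloor> - \<lfloor>c\<rfloor>\<bar> \<le> B" for c
        unfolding B_def by linarith
      then have "\<bar>\<lfloor>(c + 1) * q * x\<rfloor> - \<lfloor>c * q * x\<rfloor>\<bar> \<le> B" for c
        by (metis (no_types, opaque_lifting) add.commute distrib_right mult.assoc mult_1)
      then have "\<lfloor>(real n * BS_lambda m n g + real j) * q * x\<rfloor> -
          \<lfloor>(real n * BS_lambda m n g + real j - 1) * q * x\<rfloor> \<in> {-B..B}" for j
        by (metis (no_types, lifting) abs_le_iff atLeastAtMost_iff diff_add_cancel minus_le_iff)
      then show ?thesis
        by (auto simp: mult_tile_def Let_def PiE_iff simp del: atLeastAtMost_iff)
    qed
    ultimately show ?thesis
      by (intro image_eqI[of _ _ "(tile_top ?s, tile_left ?s, tile_right ?s, tile_bottom ?s)"])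
        (auto simp: U_def mk_def)
  qed
  then have "mult_tileset m n q {of_int a..of_int a + 1} \<subseteq> mk ` U"
    unfolding mult_tileset_def by blast
  then show ?thesis
    using \<open>finite (mk ` U)\<close> finite_subset by blast
qed

lemma finite_sys_tileset:
  assumes "m > 0" "n > 0" "\<And>i. i \<in> {1..N} \<Longrightarrow> q i \<in> \<rat>"
  shows "finite (sys_tileset m n N q a)"
  unfolding sys_tileset_def using assms finite_mult_tileset by auto

lemma sys_tileset_props:
  assumes s: "s \<in> sys_tileset m n N q a"
  defines "i \<equiv> tile_color s"
  shows "i \<in> {1..N}" "snd (tile_right s) = i"
    and "\<And>k. k \<in> {1..m} \<Longrightarrow> tile_top s k = a i \<or> tile_top s k = a i + 1"
    and "fst (tile_right s) - fst (tile_left s) =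
      q i / real m * of_int (\<Sum>k=1..m. tile_top s k) - 1 / real n * of_int (\<Sum>j=1..n. tile_bottom s j)"
proof -
  obtain j g x where j: "j \<in> {1..N}" and x: "x \<in> {of_int (a j)..of_int (a j) + 1}"
    and s_eq: "s = colored_tile j (mult_tile m n (q j) g x)"
    using s by (auto simp: sys_tileset_def mult_tileset_def)
  have i: "i = j"
    by (simp add: i_def s_eq tile_color_def colored_tile_def)
  show "i \<in> {1..N}" "snd (tile_right s) = i"
    using j by (simp_all add: i) (simp add: s_eq colored_tile_def)
  show "tile_top s k = a i \<or> tile_top s k = a i + 1" if "k \<in> {1..m}" for k
    using mult_tile_top_cases[OF x that] by (simp add: i s_eq colored_tile_def)
  show "fst (tile_right s) - fst (tile_left s) =
      q i / real m * of_int (\<Sum>k=1..m. tile_top s k) - 1 / real n * of_int (\<Sum>j=1..n. tile_bottom s j)"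
    using mult_tile_balance[of m n "q j" g x] by (simp add: i s_eq colored_tile_def)
qed

text \<open>The \<open>e\<close> labels telescope to
  \<open>\<lfloor>v + e * x\<rfloor> - \<lfloor>v\<rfloor>\<close> for a real \<open>v\<close>. Any
  integer bounding \<open>e * x\<close> from below or above bounds this difference too, so
  membership of the slope in the interval gives the exact counts in every window.\<close>

lemma floor_window:
  fixes u x :: real and a :: int and e :: nat
  defines "f \<equiv> \<lambda>j::int. \<lfloor>(u + of_int j + 1) * x\<rfloor> - \<lfloor>(u + of_int j) * x\<rfloor>"
  assumes x: "of_int a \<le> x" "x \<le> of_int a + 1" and "e > 0"
  shows "of_int a + real d / real e \<le> x \<Longrightarrow> d \<le> card {j \<in> {s..<s + int e}. f j = a + 1}"
    and "x \<le> of_int a + 1 - real d / real e \<Longrightarrow> d \<le> card {j \<in> {s..<s + int e}. f j = a}"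
proof -
  have f: "f j = a \<or> f j = a + 1" for j
    using floor_add_cases[OF x, of "(u + of_int j) * x"] by (simp add: f_def algebra_simps)
  have sum: "(\<Sum>j<e. f (s + int j)) = \<lfloor>(u + of_int s) * x + real e * x\<rfloor> - \<lfloor>(u + of_int s) * x\<rfloor>"
    by (induction e) (simp_all add: f_def algebra_simps)
  {
    assume "of_int a + real d / real e \<le> x"
    then have "of_int (int e * a + int d) \<le> real e * x"
      using \<open>e > 0\<close> by (simp add: field_simps)
    then have "int e * a + int d \<le> (\<Sum>j<e. f (s + int j))"
      unfolding sum by linarith
    then show "d \<le> card {j \<in> {s..<s + int e}. f j = a + 1}"
      using window_sum(1)[of f a s e, OF f] by simp
  next
    assume "x \<le> of_int a + 1 - real d / real e"
    then have "real e * x \<le> of_int (int e * (a + 1) - int d)"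
      using \<open>e > 0\<close> by (simp add: field_simps)
    then have "(\<Sum>j<e. f (s + int j)) \<le> int e * (a + 1) - int d"
      unfolding sum by linarith
    then show "d \<le> card {j \<in> {s..<s + int e}. f j = a}"
      using window_sum(2)[of f a s e, OF f] by simp
  }
qed


section \<open>Lines of a tiling\<close>

context baumslag_solitar
begin

lemma wang_shift_right:
  assumes "T \<in> wang_shift m n \<tau>" "g \<in> carrier G"
  shows "tile_right (T g) = tile_left (T (g \<cdot> A (int m)))"
proof -
  have "1 \<in> {1..m}" "1 \<in> {1..n}"
    using m_pos n_pos by auto
  then show ?thesis
    using assms unfolding wang_shift_def int_pow_int by blast
qed

text \<open>The gluing rule read from the upper tile, with \<open>k = 1\<close>; it moves all labels
  to first top edges.\<close>

lemma wang_shift_bottom: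
  assumes T: "T \<in> wang_shift m n \<tau>" and g: "g \<in> carrier G" and j: "j \<in> {1..n}"
  shows "tile_bottom (T g) j = tile_top (T (g \<cdot> b_inv \<cdot> A (int j - 1))) 1"
proof -
  let ?h = "g \<cdot> b_inv \<cdot> A (int j - 1)"
  have "?h \<in> carrier G" "1 \<in> {1..m}"
    using g m_pos by auto
  then have "tile_top (T ?h) 1 = tile_bottom (T (?h \<cdot> A (int 1 - int j) \<cdot> b)) j"
    using T j unfolding wang_shift_def by blast
  also have "?h \<cdot> A (int 1 - int j) \<cdot> b = g"
    using g by (simp add: mult_A_A) (simp add: m_assoc)
  finally show ?thesis by simp
qed

text \<open>Both top edges are glued to the same edge, the first bottom edge of the tile at
  \<open>g \<cdot> A (int k - 1) \<cdot> b\<close>.\<close>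

lemma wang_shift_top:
  assumes T: "T \<in> wang_shift m n \<tau>" and g: "g \<in> carrier G" and k: "k \<in> {1..m}"
  shows "tile_top (T g) k = tile_top (T (g \<cdot> A (int k - 1))) 1"
proof -
  have 1: "1 \<in> {1..n}" using n_pos by auto
  then have "tile_top (T g) k = tile_bottom (T (g \<cdot> A (int k - int 1) \<cdot> b)) 1"
    using T g k unfolding wang_shift_def by blast
  also have "\<dots> = tile_top (T (g \<cdot> A (int k - int 1) \<cdot> b \<cdot> b_inv \<cdot> A 0)) 1"
    using wang_shift_bottom[OF T _ 1] g by simp
  also have "g \<cdot> A (int k - int 1) \<cdot> b \<cdot> b_inv \<cdot> A 0 = g \<cdot> A (int k - 1)"
    using g by (simp add: m_assoc)
  finally show ?thesis .
qed

lemma wang_shift_tile: "T \<in> wang_shift m n \<tau> \<Longrightarrow> g \<in> carrier G \<Longrightarrow> T g \<in> \<tau>"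
  by (auto simp: wang_shift_def)

text \<open>Vertical edges link \<open>g\<close> only to its translates by multiples of
  \<open>m\<close> steps, so the color propagates along these.\<close>

lemma color_line:
  assumes T: "T \<in> wang_shift m n (sys_tileset m n N q a)" and g: "g \<in> carrier G"
  shows "tile_color (T (g \<cdot> A (t * int m))) = tile_color (T g)"
proof -
  have step: "tile_color (T (g \<cdot> A ((t + 1) * int m))) = tile_color (T (g \<cdot> A (t * int m)))" for t
  proof -
    let ?h = "g \<cdot> A (t * int m)"
    have h: "?h \<in> carrier G" using g by simp
    have "tile_color (T (?h \<cdot> A (int m))) = snd (tile_right (T ?h))"
      using wang_shift_right[OF T h] by (simp add: tile_color_def)
    also have "\<dots> = tile_color (T ?h)"
      by (rule sys_tileset_props(2)[OF wang_shift_tile[OF T h]])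
    finally show ?thesis
      using g by (simp add: mult_A_A distrib_right)
  qed
  show ?thesis
  proof (induction t rule: int_induct[where k = 0])
    case base
    show ?case using g by simp
  next
    case (step1 t)
    then show ?case using step[of t] by simp
  next
    case (step2 t)
    then show ?case using step[of "t - 1"] by simp
  qed
qed

text \<open>The tiles at multiples of \<open>m\<close> steps from \<open>g\<close> share its color,
  and their \<open>m\<close> top edges each cover the whole line. So the color of \<open>g\<close>
  constrains every label, including those read at the other residues.\<close>

lemma line_label_cases:
  assumes T: "T \<in> wang_shift m n (sys_tileset m n N q a)" and g: "g \<in> carrier G"
  shows "tile_top (T (g \<cdot> A j)) 1 = a (tile_color (T g)) \<or>
    tile_top (T (g \<cdot> A j)) 1 = a (tile_color (T g)) + 1"
proof -
  define t k where "t = j div int m" and "k = nat (j mod int m) + 1"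
  have k: "k \<in> {1..m}" "int k - 1 = j mod int m"
    using m_pos pos_mod_bound[of "int m" j] pos_mod_sign[of "int m" j]
    unfolding k_def atLeastAtMost_iff by linarith+
  have h: "g \<cdot> A (t * int m) \<in> carrier G"
    using g by simp
  have "tile_top (T (g \<cdot> A j)) 1 = tile_top (T (g \<cdot> A (t * int m))) k"
    using wang_shift_top[OF T h k(1)] g by (simp add: mult_A_A k(2) t_def)
  then show ?thesis
    using sys_tileset_props(3)[OF wang_shift_tile[OF T h] k(1)] by (simp add: color_line[OF T g])
qed

text \<open>The vertical colors telescope along a line of \<open>P\<close> tiles; the tops of these tiles cover
  \<open>m\<close> periods of their line and the bottoms cover \<open>n\<close> periods of the line below.\<close>

lemma line_sum_below:
  assumes T: "T \<in> wang_shift m n (sys_tileset m n N q a)" and g: "g \<in> carrier G"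
    and per: "\<And>g. g \<in> carrier G \<Longrightarrow> T (g \<cdot> A (int P)) = T g"
  shows "q (tile_color (T g)) * of_int (\<Sum>j<P. tile_top (T (g \<cdot> A (int j))) 1) =
    of_int (\<Sum>j<P. tile_top (T (g \<cdot> b_inv \<cdot> A (int j))) 1)"
proof -
  define f where "f g j = tile_top (T (g \<cdot> A (int j))) 1" for g j
  define h where "h t = g \<cdot> A (int (t * m))" for t
  define D where "D t = fst (tile_left (T (h t)))" for t
  let ?q = "q (tile_color (T g))"
  have h: "h t \<in> carrier G" for t
    using g by (simp add: h_def)
  have f_per: "f g (j + P) = f g j" if "g \<in> carrier G" for g j
    using per[of "g \<cdot> A (int j)"] that by (simp add: f_def mult_A_A)
  have step: "D (Suc t) - D t =
      ?q / real m * of_int (\<Sum>k<m. f g (t * m + k)) -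
      1 / real n * of_int (\<Sum>k<n. f (g \<cdot> b_inv) (t * n + k))" for t
  proof -
    have "h (Suc t) = h t \<cdot> A (int m)"
      using g by (simp add: h_def mult_A_A add.commute)
    then have "D (Suc t) = fst (tile_right (T (h t)))"
      by (simp add: D_def wang_shift_right[OF T h])
    moreover have "tile_color (T (h t)) = tile_color (T g)"
      using color_line[OF T g, of "int t"] by (simp add: h_def)
    moreover have "(\<Sum>k=1..m. tile_top (T (h t)) k) = (\<Sum>k<m. f g (t * m + k))"
    proof -
      have "tile_top (T (h t)) (Suc k) = f g (t * m + k)" if "k < m" for k
        using wang_shift_top[OF T h, of "Suc k"] that g by (simp add: h_def f_def mult_A_A)
      then show ?thesis
        by (simp add: sum.atLeast1_atMost_eq)
    qed
    moreover have "(\<Sum>k=1..n. tile_bottom (T (h t)) k) = (\<Sum>k<n. f (g \<cdot> b_inv) (t * n + k))"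
    proof -
      \<comment> \<open>Tile \<open>t\<close> starts \<open>t * m\<close> steps along its line,
        hence \<open>t * n\<close> steps along the line below.\<close>
      have "h t \<cdot> b_inv = g \<cdot> b_inv \<cdot> A (int (t * n))"
        using g A_mult_m_b_inv[of t] by (simp add: h_def m_assoc del: of_nat_mult)
      then have "tile_bottom (T (h t)) (Suc k) = f (g \<cdot> b_inv) (t * n + k)" if "k < n" for k
        using wang_shift_bottom[OF T h, of "Suc k"] that g by (simp add: f_def mult_A_A)
      then show ?thesis
        by (simp add: sum.atLeast1_atMost_eq)
    qed
    ultimately show ?thesis
      using sys_tileset_props(4)[OF wang_shift_tile[OF T h], of t] unfolding D_def by (simp only:)
  qed
  have "T (g \<cdot> A (int (i * P))) = T g" for i
  proof (induction i)
    case (Suc i)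
    then show ?case
      using per[of "g \<cdot> A (int (i * P))"] g by (simp add: mult_A_A add.commute)
  qed (use g in simp)
  \<comment> \<open>The tile reached after \<open>P\<close> tiles is \<open>m\<close> full periods
    away, so the telescoping sum vanishes.\<close>
  from this[of m] have "D P = D 0"
    using g by (simp add: D_def h_def mult.commute)
  then have "0 = (\<Sum>t<P. D (Suc t) - D t)"
    by (simp add: sum_lessThan_telescope)
  also have "\<dots> = ?q / real m * of_int (\<Sum>t<P. \<Sum>k<m. f g (t * m + k)) -
      1 / real n * of_int (\<Sum>t<P. \<Sum>k<n. f (g \<cdot> b_inv) (t * n + k))"
    unfolding step by (simp add: sum_subtractf sum_distrib_left)
  also have "\<dots> = ?q * of_int (\<Sum>j<P. f g j) - of_int (\<Sum>j<P. f (g \<cdot> b_inv) j)"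
    using m_pos n_pos g
    by (simp add: sum_periodic f_per mult.commute[of P] flip: sum_blocks)
  finally show ?thesis
    by (simp add: f_def)
qed

text \<open>The averages \<open>z k\<close> on the lines of the powers of \<open>b_inv\<close> are
  all taken over the same period \<open>P\<close>, which makes consecutive ones comparable;
  periodicity along \<open>b_inv\<close> then closes the orbit.\<close>

lemma strongly_periodic_imp_periodic_point:
  assumes T: "T \<in> sys_subshift m n N q a d1 e1 d2 e2"
    and e: "\<And>i. i \<in> {1..N} \<Longrightarrow> e1 i > 0 \<and> e2 i > 0"
    and I: "\<And>i. i \<in> {1..N} \<Longrightarrow> I i = {of_int (a i) + real (d1 i) / real (e1 i) ..
                  of_int (a i) + 1 - real (d2 i) / real (e2 i)}"
    and per: "strongly_periodic G T"
  shows "\<exists>x. periodic_point ((\<lambda>i. linear_on (q i) (I i)) ` {1..N}) x"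
proof -
  have W: "T \<in> wang_shift m n (sys_tileset m n N q a)"
    using T by (simp add: sys_subshift_def)
  obtain P where P: "P > 0"
    "\<And>g h. g \<in> carrier G \<Longrightarrow> h \<in> carrier G \<Longrightarrow> T (g \<cdot> A (int P) \<cdot> h) = T (g \<cdot> h)"
    using strongly_periodic_uniform_period[OF per gens_closed(1)] by (auto simp: int_pow_int)
  obtain K :: nat where K: "K > 0"
    "\<And>g h. g \<in> carrier G \<Longrightarrow> h \<in> carrier G \<Longrightarrow> T (g \<cdot> b_inv [^]\<^bsub>G\<^esub> K \<cdot> h) = T (g \<cdot> h)"
    using strongly_periodic_uniform_period[OF per, of b_inv] by auto
  have per_a: "T (g \<cdot> A (int P)) = T g" if "g \<in> carrier G" for g
    using P(2)[OF that one_closed] that by simp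
  define g where "g k = b_inv [^]\<^bsub>G\<^esub> k" for k :: nat
  define c where "c k = tile_color (T (g k))" for k
  define z where "z k = of_int (\<Sum>j<P. tile_top (T (g k \<cdot> A (int j))) 1) / real P" for k
  have g: "g k \<in> carrier G" for k
    by (simp add: g_def)
  have c: "c k \<in> {1..N}" for k
    unfolding c_def by (rule sys_tileset_props(1)[OF wang_shift_tile[OF W g]])
  have "z (Suc k) = q (c k) * z k" for k
    using line_sum_below[OF W g[of k] per_a] by (simp add: z_def c_def g_def)
  moreover have "z k \<in> I (c k)" for k
  proof -
    define f where "f j = tile_top (T (g k \<cdot> A j)) 1" for j
    have f: "f j = a (c k) \<or> f j = a (c k) + 1" for j
      unfolding f_def c_def by (rule line_label_cases[OF W g])
    have f_per: "f (j + int P) = f j" for j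
      using per_a[of "g k \<cdot> A j"] g by (simp add: f_def mult_A_A)
    have "d1 (c k) \<le> card {j \<in> {s..<s + int (e1 (c k))}. f j = a (c k) + 1}"
      "d2 (c k) \<le> card {j \<in> {s..<s + int (e2 (c k))}. f j = a (c k)}" for s
      using T g[of k] by (auto simp: sys_subshift_def Let_def c_def f_def)
    then show ?thesis
      using periodic_window_density[of f "a (c k)" P, OF f f_per P(1)] e[OF c[of k]]
      by (simp add: I[OF c] z_def f_def)
  qed
  \<comment> \<open>The line of \<open>g K\<close> carries the same labels as that of
    \<open>g 0\<close>.\<close>
  moreover have "z K = z 0"
    using K(2)[OF one_closed] by (simp add: z_def g_def)
  ultimately have "z 0 \<in> sys_iterates ((\<lambda>i. linear_on (q i) (I i)) ` {1..N}) K (z 0)"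
    using c unfolding sys_iterates_linear_iff by blast
  then show ?thesis
    using K(1) unfolding periodic_point_def by (auto simp: Suc_le_eq)
qed

end


section \<open>Finite type\<close>

context baumslag_solitar
begin

text \<open>Colors repeat every \<open>m\<close> positions along a line, so it suffices to check the windows that
  start at most \<open>m\<close> positions after a tile.\<close>

lemma is_SFT_sys_subshift:
  assumes fin: "finite (sys_tileset m n N q a)"
  shows "is_SFT G (sys_tileset m n N q a) (sys_subshift m n N q a d1 e1 d2 e2)"
proof -
  define \<tau> where "\<tau> = sys_tileset m n N q a"
  define card_ok where "card_ok i s f \<longleftrightarrow>
      card {j \<in> {s..<s + int (e1 i)}. f j = a i + 1} \<ge> d1 i \<and>
      card {j \<in> {s..<s + int (e2 i)}. f j = a i} \<ge> d2 i"
    for i :: nat and s :: int and f :: "int \<Rightarrow> int"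
  \<comment> \<open>Colors and window starts range over finite sets, so that \<open>lc\<close> looks
    only at the finite \<open>W\<close>: windows starting before \<open>m\<close> end before
    \<open>m + e1 i + e2 i\<close>.\<close>
  define lc :: "(letter list set \<Rightarrow> (int, real \<times> nat) wang_tile) \<Rightarrow> bool" where
    "lc z \<longleftrightarrow> (\<forall>k\<in>{1..m}. \<forall>j\<in>{1..n}. tile_right (z \<one>\<^bsub>G\<^esub>) = tile_left (z (A (int m))) \<and>
        tile_top (z \<one>\<^bsub>G\<^esub>) k = tile_bottom (z (A (int k - int j) \<cdot> b)) j) \<and>
      (\<forall>i\<in>{1..N}. tile_color (z \<one>\<^bsub>G\<^esub>) = i \<longrightarrow>
        (\<forall>s\<in>{0..<int m}. card_ok i s (\<lambda>j. tile_top (z (A j)) 1)))" for z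
  define W where "W = {\<one>\<^bsub>G\<^esub>, A (int m)} \<union> (\<lambda>(k, j). A (int k - int j) \<cdot> b) ` ({1..m} \<times> {1..n}) \<union>
    (\<Union>i\<in>{1..N}. A ` {0..<int m + int (e1 i) + int (e2 i)})"
  have "finite W" "W \<subseteq> carrier G"
    by (auto simp: W_def)
  moreover have "lc y" if xy: "\<And>h. h \<in> W \<Longrightarrow> x h = y h" and x: "lc x" for x y
  proof -
    have "x \<one>\<^bsub>G\<^esub> = y \<one>\<^bsub>G\<^esub>" "x (A (int m)) = y (A (int m))"
      by (auto intro!: xy simp: W_def)
    moreover have "x (A (int k - int j) \<cdot> b) = y (A (int k - int j) \<cdot> b)"
      if "k \<in> {1..m}" "j \<in> {1..n}" for k j
    proof (rule xy)
      have "A (int k - int j) \<cdot> b \<in> (\<lambda>(k, j). A (int k - int j) \<cdot> b) ` ({1..m} \<times> {1..n})"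
        using that by (intro image_eqI[of _ _ "(k, j)"]) auto
      then show "A (int k - int j) \<cdot> b \<in> W"
        by (simp only: W_def Un_iff simp_thms)
    qed
    moreover have "card_ok i s (\<lambda>j. tile_top (x (A j)) 1) = card_ok i s (\<lambda>j. tile_top (y (A j)) 1)"
      if "i \<in> {1..N}" "s \<in> {0..<int m}" for i s
    proof -
      have "x (A j) = y (A j)" if "s \<le> j" "j < s + int (e1 i) \<or> j < s + int (e2 i)" for j
        using that \<open>i \<in> {1..N}\<close> \<open>s \<in> {0..<int m}\<close>
        by (intro xy) (auto simp: W_def intro!: bexI[of _ i])
      then have "{j \<in> {s..<s + int (e1 i)}. tile_top (x (A j)) 1 = a i + 1} =
          {j \<in> {s..<s + int (e1 i)}. tile_top (y (A j)) 1 = a i + 1}"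
        "{j \<in> {s..<s + int (e2 i)}. tile_top (x (A j)) 1 = a i} =
          {j \<in> {s..<s + int (e2 i)}. tile_top (y (A j)) 1 = a i}"
        by auto
      then show ?thesis
        by (simp only: card_ok_def)
    qed
    ultimately show ?thesis
      using x unfolding lc_def by simp
  qed
  ultimately have "is_SFT G \<tau> {T \<in> carrier G \<rightarrow>\<^sub>E \<tau>. \<forall>g\<in>carrier G. lc (\<lambda>h. T (g \<cdot> h))}"
    using fin unfolding \<tau>_def by (intro is_SFT_local) auto
  also have "{T \<in> carrier G \<rightarrow>\<^sub>E \<tau>. \<forall>g\<in>carrier G. lc (\<lambda>h. T (g \<cdot> h))} =
    sys_subshift m n N q a d1 e1 d2 e2"
  proof -
    have "(\<forall>g\<in>carrier G. lc (\<lambda>h. T (g \<cdot> h))) \<longleftrightarrow> T \<in> sys_subshift m n N q a d1 e1 d2 e2"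
      if T: "T \<in> carrier G \<rightarrow>\<^sub>E \<tau>" for T
    proof -
      have "T \<in> wang_shift m n \<tau> \<longleftrightarrow> (\<forall>g\<in>carrier G. \<forall>k\<in>{1..m}. \<forall>j\<in>{1..n}.
          tile_right (T (g \<cdot> \<one>\<^bsub>G\<^esub>)) = tile_left (T (g \<cdot> A (int m))) \<and>
          tile_top (T (g \<cdot> \<one>\<^bsub>G\<^esub>)) k = tile_bottom (T (g \<cdot> (A (int k - int j) \<cdot> b))) j)"
        using T by (simp add: wang_shift_def int_pow_int m_assoc)
      moreover have "(\<forall>g\<in>carrier G. \<forall>i. tile_color (T g) = i \<longrightarrow>
            (\<forall>s. card_ok i s (\<lambda>j. tile_top (T (g \<cdot> A j)) 1))) \<longleftrightarrow>
          (\<forall>g\<in>carrier G. \<forall>i\<in>{1..N}. tile_color (T (g \<cdot> \<one>\<^bsub>G\<^esub>)) = i \<longrightarrow>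
            (\<forall>s\<in>{0..<int m}. card_ok i s (\<lambda>j. tile_top (T (g \<cdot> A j)) 1)))" (is "?glob \<longleftrightarrow> ?loc")
        if wang: "T \<in> wang_shift m n \<tau>"
      proof
        assume ?glob
        then show ?loc by simp
      next
        assume loc: ?loc
        show ?glob
        proof (intro ballI allI impI)
          fix g i s assume g: "g \<in> carrier G" and i: "tile_color (T g) = i"
          \<comment> \<open>Moving the base point by the multiple \<open>t * m\<close> of
            \<open>m\<close> keeps the color and brings the start of the window into
            \<open>{0..<m}\<close>; the window at \<open>r\<close> seen from \<open>h\<close> is the
            window at \<open>s\<close> seen from \<open>g\<close>.\<close>
          define t r where "t = s div int m" and "r = s mod int m"
          define h where "h = g \<cdot> A (t * int m)"
          have h: "h \<in> carrier G" "tile_color (T h) = i"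
            using g i wang color_line by (auto simp: h_def \<tau>_def)
          have "i \<in> {1..N}"
            using sys_tileset_props(1)[OF wang_shift_tile[OF wang[unfolded \<tau>_def] g]] i by simp
          moreover have "r \<in> {0..<int m}"
            using m_pos by (simp add: r_def)
          ultimately have "card_ok i r (\<lambda>j. tile_top (T (h \<cdot> A j)) 1)"
            using loc h by auto
          moreover have "h \<cdot> A (r + j) = g \<cdot> A (s + j)" for j
          proof -
            have "t * int m + (r + j) = s + j"
              using div_mult_mod_eq[of s "int m"] by (simp add: t_def r_def)
            then show ?thesis
              using g unfolding h_def by (simp only: mult_A_A)
          qed
          ultimately show "card_ok i s (\<lambda>j. tile_top (T (g \<cdot> A j)) 1)"
            unfolding card_ok_def card_window by simp
        qed
      qed
      ultimately show ?thesis
        unfolding lc_def sys_subshift_def Let_def mem_Collect_eq card_ok_def[symmetric] \<tau>_def[symmetric]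
        by (simp only: ball_conj_distrib) blast
    qed
    moreover have "sys_subshift m n N q a d1 e1 d2 e2 \<subseteq> carrier G \<rightarrow>\<^sub>E \<tau>"
      by (auto simp: sys_subshift_def wang_shift_def \<tau>_def)
    ultimately show ?thesis by blast
  qed
  finally show ?thesis
    by (simp add: \<tau>_def)
qed


section \<open>Tiling by a two-sided orbit\<close>

lemma sys_subshift_nonempty:
  assumes c: "\<And>k :: int. c k \<in> {1..N}" and z: "\<And>k. z k \<in> I (c k)"
    and orbit: "\<And>k. z (k + 1) = q (c k) * z k"
    and e: "\<And>i. i \<in> {1..N} \<Longrightarrow> e1 i > 0 \<and> e2 i > 0"
    and I: "\<And>i. i \<in> {1..N} \<Longrightarrow> I i = {of_int (a i) + real (d1 i) / real (e1 i) ..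
                  of_int (a i) + 1 - real (d2 i) / real (e2 i)}"
  shows "sys_subshift m n N q a d1 e1 d2 e2 \<noteq> {}"
proof -
  \<comment> \<open>Bottoms of \<open>g \<cdot> b\<close> are glued to tops on the line of
    \<open>g\<close>, and bottoms carry \<open>q\<close> times the parameter of the tops. The orbit
    must therefore advance as the height drops, whence the sign.\<close>
  define C where "C g = c (- BS_height g)" for g
  define x where "x g = z (- BS_height g)" for g
  define T where "T = (\<lambda>g\<in>carrier G. colored_tile (C g) (mult_tile m n (q (C g)) g (x g)))"
  have x_I: "x g \<in> I (C g)" and C: "C g \<in> {1..N}" for g
    unfolding x_def C_def by (rule z, rule c)
  have x_lower: "of_int (a (C g)) + real (d1 (C g)) / real (e1 (C g)) \<le> x g"
    and x_upper: "x g \<le> of_int (a (C g)) + 1 - real (d2 (C g)) / real (e2 (C g))" for g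
    using x_I[of g] by (simp_all add: I[OF C])
  have x_unit: "x g \<in> {of_int (a (C g))..of_int (a (C g)) + 1}" for g
    using x_lower[of g] x_upper[of g]
    by (auto intro: order_trans[rotated] order_trans simp: field_simps)
  have C_A: "C (g \<cdot> A j) = C g" and x_A: "x (g \<cdot> A j) = x g" if "g \<in> carrier G" for g j
    using that by (simp_all add: C_def x_def)
  \<comment> \<open>Along a line the parameter is constant and the position grows by one per step,
    so the labels form a rotation word of slope \<open>x g\<close>.\<close>
  have label: "tile_top (T (g \<cdot> A j)) 1 =
      \<lfloor>(real m * BS_lambda m n g + of_int j + 1) * x g\<rfloor> - \<lfloor>(real m * BS_lambda m n g + of_int j) * x g\<rfloor>"
    if "g \<in> carrier G" for g j
    using that m_pos
    by (simp add: T_def colored_tile_def mult_tile_def Let_def x_A lambda_mult_A)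
  have "T g \<in> sys_tileset m n N q a" if "g \<in> carrier G" for g
  proof -
    have "mult_tile m n (q (C g)) g (x g) \<in> mult_tileset m n (q (C g)) {of_int (a (C g))..of_int (a (C g)) + 1}"
      unfolding mult_tileset_def using that x_unit[of g] by blast
    then show ?thesis
      unfolding sys_tileset_def T_def restrict_apply'[OF that] by (intro UN_I[OF C[of g]] imageI)
  qed
  then have "T \<in> carrier G \<rightarrow>\<^sub>E sys_tileset m n N q a"
    by (auto simp: T_def)
  moreover have "tile_right (T g) = tile_left (T (g \<cdot> A (int m)))" if g: "g \<in> carrier G" for g
  proof -
    have "real m * BS_lambda m n (g \<cdot> A (int m)) = real m * BS_lambda m n g + real m"
      using g by (simp add: lambda_mult_A)
    moreover from this have "real m * BS_lambda m n (g \<cdot> A (int m)) = real m * (BS_lambda m n g + 1)"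
      by (simp add: distrib_left)
    then have "BS_lambda m n (g \<cdot> A (int m)) = BS_lambda m n g + 1"
      using m_pos by (simp only: mult_cancel_left) simp
    then have "real n * BS_lambda m n (g \<cdot> A (int m)) = real n * BS_lambda m n g + real n"
      by (simp add: distrib_left)
    ultimately show ?thesis
      using g by (simp add: T_def colored_tile_def mult_tile_def Let_def x_A C_A)
  qed
  moreover have "tile_top (T g) k = tile_bottom (T (g \<cdot> A (int k - int j) \<cdot> b)) j"
    if g: "g \<in> carrier G" and k: "k \<in> {1..m}" and j: "j \<in> {1..n}" for g k j
  proof -
    let ?h = "g \<cdot> A (int k - int j) \<cdot> b"
    have "BS_height ?h = BS_height g + 1"
      using g by (simp add: height_mult height_alpha_gens height_alpha_A)
    \<comment> \<open>The tile above is one orbit step earlier, so its image under multiplication is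
      the parameter of the tile below.\<close>
    then have "q (C ?h) * x ?h = x g"
      using orbit[of "- BS_height g - 1"] by (simp add: C_def x_def)
    moreover have "real n * BS_lambda m n ?h = real m * BS_lambda m n g + real k - real j"
      using lambda_mult_A_b[OF g, of "int k - int j"] by simp
    ultimately show ?thesis
      using g k j by (simp add: T_def colored_tile_def mult_tile_def Let_def mult.assoc)
  qed
  ultimately have "T \<in> wang_shift m n (sys_tileset m n N q a)"
    by (auto simp: wang_shift_def int_pow_int)
  moreover have "tile_color (T g) = C g" if "g \<in> carrier G" for g
    using that by (simp add: T_def tile_color_def colored_tile_def)
  ultimately have "T \<in> sys_subshift m n N q a d1 e1 d2 e2"
    using floor_window(1)[OF _ _ _ x_lower] floor_window(2)[OF _ _ _ x_upper] e[OF C] x_unit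
    by (simp add: sys_subshift_def Let_def label[unfolded One_nat_def])
  then show ?thesis by blast
qed

end

text \<open>Absence of periodic points alone does not give a tiling: for \<open>N = 0\<close> there
  are no tiles and \<open>Y\<close> is empty. Non-emptiness is therefore derived from an immortal
  point, while finite type and the exclusion of strongly periodic tilings are stated
  separately.\<close>

theorem theorem2p6:
  fixes m n N :: nat
    and q :: "nat \<Rightarrow> real" and I :: "nat \<Rightarrow> real set" and a :: "nat \<Rightarrow> int"
    and d1 e1 d2 e2 :: "nat \<Rightarrow> nat"
    and S :: "(real \<rightharpoonup> real) set"
    and Y :: "(letter list set \<Rightarrow> (int, real \<times> nat) wang_tile) set"
  assumes "m \<ge> 1" and "n \<ge> 1"
    and "\<And>i. i \<in> {1..N} \<Longrightarrow> q i \<in> \<rat> - {0}"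
    and "\<And>i. i \<in> {1..N} \<Longrightarrow> e1 i \<ge> 1 \<and> e2 i \<ge> 1"
    and "\<And>i. i \<in> {1..N} \<Longrightarrow>
           I i = {of_int (a i) + real (d1 i) / real (e1 i) ..
                  of_int (a i) + 1 - real (d2 i) / real (e2 i)} \<and> I i \<noteq> {}"
    and "S = (\<lambda>i. linear_on (q i) (I i)) ` {1..N}"
    and "Y = sys_subshift m n N q a d1 e1 d2 e2"
    and "\<not> (\<exists>x. periodic_point S x)"
  shows "is_SFT (BS m n) (sys_tileset m n N q a) Y
         \<and> (\<forall>T\<in>Y. \<not> strongly_periodic (BS m n) T)
         \<and> ((\<exists>x. immortal_point S x) \<longrightarrow> weakly_aperiodic (BS m n) Y)"
proof -
  interpret baumslag_solitar m n
    using assms(1,2) by unfold_locales auto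
  have e: "e1 i > 0 \<and> e2 i > 0" if "i \<in> {1..N}" for i
    using assms(4)[OF that] by auto
  have I: "I i = {of_int (a i) + real (d1 i) / real (e1 i) ..
                  of_int (a i) + 1 - real (d2 i) / real (e2 i)}" if "i \<in> {1..N}" for i
    using assms(5)[OF that] by blast
  have "finite (sys_tileset m n N q a)"
    using assms(3) m_pos n_pos by (intro finite_sys_tileset) auto
  then have "is_SFT G (sys_tileset m n N q a) Y"
    unfolding assms(7) by (rule is_SFT_sys_subshift)
  moreover have aperiodic: "\<not> strongly_periodic G T" if "T \<in> Y" for T
    using strongly_periodic_imp_periodic_point[of T N q a d1 e1 d2 e2 I, OF _ e I] that assms(6-8) by blast
  moreover have "weakly_aperiodic G Y" if immortal: "immortal_point S x" for x
  proof -
    have compact: "compact (I i)" if "i \<in> {1..N}" for i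
      by (simp add: I[OF that])
    have "\<exists>c z. \<forall>k::int. c k \<in> {1..N} \<and> z k \<in> I (c k) \<and> z (k + 1) = q (c k) * z k"
      by (rule immortal_point_two_sided_orbit[OF _ compact immortal[unfolded assms(6)]]) simp_all
    then obtain c z where cz:
      "\<And>k. c k \<in> {1..N}" "\<And>k. z k \<in> I (c k)" "\<And>k::int. z (k + 1) = q (c k) * z k"
      by metis
    show ?thesis
      using sys_subshift_nonempty[where c = c and z = z and q = q and I = I, OF cz e I] aperiodic
      by (auto simp: weakly_aperiodic_def assms(7))
  qed
  ultimately show ?thesis by blast
qed

end
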